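(* Let $\mathcal H$ be a real Hilbert space and $Q:\mathcal H\to\mathcal H$ a bounded self-adjoint operator with spectrum $\sigma(Q)$ satisfying $0<\mu=\min\sigma(Q)\le\max\sigma(Q)=L$. Let $\gamma,\beta\ge0$ and $h>0$. For $q\in\sigma(Q)$ let $$T_q=\begin{pmatrix}1-\dfrac{h^2q}{1+h\gamma}&\dfrac{h(1-hq\beta)}{1+h\gamma}\\[1em]-\dfrac{hq}{1+h\gamma}&\dfrac{1-hq\beta}{1+h\gamma}\end{pmatrix}$$ be the scalar symbols of the frictionless quadratic iteration $$v_{k+1}=\frac{1}{1+h\gamma}\bigl(v_k-hQ(z_k+\beta v_k)\bigr),\qquad z_{k+1}=z_k+hv_{k+1}.$$ If $(\gamma,\beta)\ne(0,0)$, the iteration is uniformly Schur stable, i.e. $\sup_{q\in\sigma(Q)}\rho(T_q)<1$, if and only if $$0<h<h_{\mathrm{quad}},\qquad h_{\mathrm{quad}}=\frac{\gamma-L\beta+\sqrt{(\gamma-L\beta)^2+4L}}{L}.$$ At $h=h_{\mathrm{quad}}$, the symbol $T_L$ has the eigenvalue $-1$; for $h>h_{\mathrm{quad}}$, $T_L$ is unstable. If $\gamma=\beta=0$, the iteration is marginally stable, but not Schur stable, precisely for $0<h<2/\sqrt L$.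
   Context: $\rho(\cdot)$ denotes spectral radius. A matrix is unstable if its spectral radius exceeds $1$, and marginally stable if its spectral radius equals $1$ and every eigenvalue of modulus one is semisimple. The iteration is called marginally stable when every symbol $T_q$, $q\in\sigma(Q)$, is marginally stable. *)

theory Defs
  imports
    "HOL-Analysis.Bounded_Linear_Function"
    "Jordan_Normal_Form.Spectral_Radius"
    "Jordan_Normal_Form.Matrix_Kernel"
begin

text \<open>
  The real spectrum of a bounded operator: those \<open>q\<close> for which \<open>Q - q I\<close> has no bounded two-sided
  inverse. For self-adjoint \<open>Q\<close> the spectrum of the complexification of \<open>Q\<close> is real, so this set is
  the whole spectrum.
\<close>

definition op_spectrum :: "('a::real_normed_vector \<Rightarrow>\<^sub>L 'a) \<Rightarrow> real set" where
  "op_spectrum Q =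
     {q. \<not> (\<exists>R. R o\<^sub>L (Q - q *\<^sub>R id_blinfun) = id_blinfun \<and>
              (Q - q *\<^sub>R id_blinfun) o\<^sub>L R = id_blinfun)}"

definition self_adjoint :: "('a::real_inner \<Rightarrow>\<^sub>L 'a) \<Rightarrow> bool" where
  "self_adjoint Q \<longleftrightarrow> (\<forall>x y. inner (blinfun_apply Q x) y = inner x (blinfun_apply Q y))"

definition is_minimum :: "real set \<Rightarrow> real \<Rightarrow> bool" where
  "is_minimum S m \<longleftrightarrow> m \<in> S \<and> (\<forall>x\<in>S. m \<le> x)"

definition is_maximum :: "real set \<Rightarrow> real \<Rightarrow> bool" where
  "is_maximum S m \<longleftrightarrow> m \<in> S \<and> (\<forall>x\<in>S. x \<le> m)"

definition quad_step ::
  "('a::real_normed_vector \<Rightarrow>\<^sub>L 'a) \<Rightarrow> real \<Rightarrow> real \<Rightarrow> real \<Rightarrow> 'a \<times> 'a \<Rightarrow> 'a \<times> 'a" where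
  "quad_step Q \<gamma> \<beta> h = (\<lambda>(z, v).
     let v' = (1 / (1 + h * \<gamma>)) *\<^sub>R (v - h *\<^sub>R blinfun_apply Q (z + \<beta> *\<^sub>R v))
     in (z + h *\<^sub>R v', v'))"

text \<open>
  The symbol is a real matrix; it is read over the complex numbers so that its eigenvalues
  and its spectral radius are the complex ones. It acts on column vectors \<open>(z, v)\<close>.
\<close>

definition symbol :: "real \<Rightarrow> real \<Rightarrow> real \<Rightarrow> real \<Rightarrow> complex mat" where
  "symbol \<gamma> \<beta> h q = map_mat complex_of_real (mat_of_rows_list 2
     [[1 - h\<^sup>2 * q / (1 + h * \<gamma>), h * (1 - h * q * \<beta>) / (1 + h * \<gamma>)],
      [- (h * q / (1 + h * \<gamma>)), (1 - h * q * \<beta>) / (1 + h * \<gamma>)]])"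

lemma quad_step_symbol:
  assumes "blinfun_apply Q x = q *\<^sub>R x"
    and "symbol \<gamma> \<beta> h q *\<^sub>v vec_of_list [complex_of_real a, complex_of_real b]
           = vec_of_list [complex_of_real a', complex_of_real b']"
  shows "quad_step Q \<gamma> \<beta> h (a *\<^sub>R x, b *\<^sub>R x) = (a' *\<^sub>R x, b' *\<^sub>R x)"
proof -
  let ?w = "vec_of_list [complex_of_real a, complex_of_real b]"
  have "(symbol \<gamma> \<beta> h q *\<^sub>v ?w) $ 0 = complex_of_real a'"
    "(symbol \<gamma> \<beta> h q *\<^sub>v ?w) $ 1 = complex_of_real b'"
    unfolding assms(2) by simp_all
  then have "complex_of_real ((1 - h\<^sup>2 * q / (1 + h * \<gamma>)) * a
        + h * (1 - h * q * \<beta>) / (1 + h * \<gamma>) * b) = complex_of_real a'"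
    "complex_of_real (- (h * q / (1 + h * \<gamma>)) * a
        + (1 - h * q * \<beta>) / (1 + h * \<gamma>) * b) = complex_of_real b'"
    by (simp_all add: symbol_def mat_of_rows_list_def scalar_prod_def numeral_2_eq_2
        vec_of_list_index)
  then have a': "a' = (1 - h\<^sup>2 * q / (1 + h * \<gamma>)) * a
        + h * (1 - h * q * \<beta>) / (1 + h * \<gamma>) * b"
    and b': "b' = - (h * q / (1 + h * \<gamma>)) * a + (1 - h * q * \<beta>) / (1 + h * \<gamma>) * b"
    by (simp_all only: of_real_eq_iff)
  let ?c = "(1 / (1 + h * \<gamma>)) * (b - h * (q * a + \<beta> * q * b))"
  have v: "(1 / (1 + h * \<gamma>)) *\<^sub>R (b *\<^sub>R x - h *\<^sub>R blinfun_apply Q (a *\<^sub>R x + \<beta> *\<^sub>R b *\<^sub>R x))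
        = ?c *\<^sub>R x"
    by (simp add: blinfun.add_right blinfun.scaleR_right assms(1) algebra_simps)
  have "?c = b'" "a + h * ?c = a'"
    by (simp_all add: a' b' divide_inverse algebra_simps power2_eq_square)
  then show ?thesis
    unfolding quad_step_def prod.case Let_def v by (metis scaleR_add_left scaleR_scaleR)
qed

text \<open>Semisimple: the algebraic and the geometric multiplicity of the eigenvalue coincide.\<close>

definition semisimple_eigenvalue :: "complex mat \<Rightarrow> complex \<Rightarrow> bool" where
  "semisimple_eigenvalue A k \<longleftrightarrow>
     eigenvalue A k \<and> Polynomial.order k (char_poly A) = kernel_dim (char_matrix A k)"

definition unstable :: "complex mat \<Rightarrow> bool" where
  "unstable A \<longleftrightarrow> spectral_radius A > 1"

definition marginally_stable :: "complex mat \<Rightarrow> bool" where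
  "marginally_stable A \<longleftrightarrow>
     spectral_radius A = 1 \<and> (\<forall>k. eigenvalue A k \<and> cmod k = 1 \<longrightarrow> semisimple_eigenvalue A k)"

text \<open>Stability of the iteration \<^const>\<open>quad_step\<close> is expressed through its symbols.\<close>

definition uniformly_schur_stable ::
  "('a::real_normed_vector \<Rightarrow>\<^sub>L 'a) \<Rightarrow> real \<Rightarrow> real \<Rightarrow> real \<Rightarrow> bool" where
  "uniformly_schur_stable Q \<gamma> \<beta> h \<longleftrightarrow>
     (SUP q\<in>op_spectrum Q. spectral_radius (symbol \<gamma> \<beta> h q)) < 1"

definition marginally_stable_iteration ::
  "('a::real_normed_vector \<Rightarrow>\<^sub>L 'a) \<Rightarrow> real \<Rightarrow> real \<Rightarrow> real \<Rightarrow> bool" where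
  "marginally_stable_iteration Q \<gamma> \<beta> h \<longleftrightarrow>
     (\<forall>q\<in>op_spectrum Q. marginally_stable (symbol \<gamma> \<beta> h q))"

definition h_quad :: "real \<Rightarrow> real \<Rightarrow> real \<Rightarrow> real" where
  "h_quad \<gamma> \<beta> L = (\<gamma> - L * \<beta> + sqrt ((\<gamma> - L * \<beta>)\<^sup>2 + 4 * L)) / L"

end

theory Submission
  imports Defs
begin

text \<open>
  The symbol has characteristic polynomial \<open>x\<^sup>2 - t x + d\<close> with \<open>d = (1 - h q \<beta>) / (1 + h \<gamma>)\<close> and
  \<open>t = 1 + d - h\<^sup>2 q / (1 + h \<gamma>)\<close>. By the Jury criterion its roots lie in the disc of radius \<open>r\<close> if
  \<open>d \<le> r\<^sup>2\<close> and \<open>r\<^sup>2 \<plusminus> r t + d \<ge> 0\<close>. For \<open>r = 1\<close> only the value at \<open>-1\<close> is critical once there is damping;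
  its sign at \<open>q = L\<close> is the sign of \<open>h_quad - h\<close>. Since the conditions hold strictly at \<open>q = \<mu>\<close> and
  \<open>q = L\<close>, they persist there for some \<open>r < 1\<close>, and being affine in \<open>q\<close> they then hold on all of \<open>[\<mu>, L]\<close>.
  Without damping \<open>d = 1\<close>, so below the threshold the eigenvalues are distinct and unimodular,
  whereas at the threshold \<open>T\<^sub>L\<close> has a nontrivial Jordan block for \<open>-1\<close>.
\<close>

unbundle no vec_syntax

section \<open>Matrices of order two\<close>

lemma det_2x2:
  fixes A :: "'a :: comm_ring_1 mat"
  assumes A: "A \<in> carrier_mat 2 2"
  shows "det A = A $$ (0,0) * A $$ (1,1) - A $$ (0,1) * A $$ (1,0)"
proof -
  have "det (mat_delete A i j) = A $$ (1 - i, 1 - j)" if "i < 2" "j < 2" for i j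
  proof -
    have "mat_delete A i j \<in> carrier_mat 1 1"
      using mat_delete_carrier[OF A, of i j] by simp
    then show ?thesis
      using that A by (auto simp: det_single mat_delete_def less_2_cases_iff)
  qed
  then show ?thesis
    using A by (subst laplace_expansion_column[OF A, of 0])
      (auto simp: numeral_2_eq_2 cofactor_def algebra_simps)
qed

lemma char_poly_2x2:
  fixes A :: "'a :: field mat"
  assumes A: "A \<in> carrier_mat 2 2"
  shows "char_poly A = [:A $$ (0,0) * A $$ (1,1) - A $$ (0,1) * A $$ (1,0),
                         - (A $$ (0,0) + A $$ (1,1)), 1:]"
proof -
  have "char_poly_matrix A \<in> carrier_mat 2 2"
    using A by simp
  then have "char_poly A = [:- (A $$ (0,0)), 1:] * [:- (A $$ (1,1)), 1:]
      - [:- (A $$ (0,1)):] * [:- (A $$ (1,0)):]"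
    unfolding char_poly_def using A by (subst det_2x2) (auto simp: char_poly_matrix_def)
  then show ?thesis
    by (simp add: algebra_simps)
qed

text \<open>The second row is nonzero, so a singular \<open>B\<close> has rank one and its kernel is
  a line.\<close>

lemma kernel_dim_2x2:
  fixes B :: "'a :: field mat"
  assumes B: "B \<in> carrier_mat 2 2" and det: "det B = 0" and nz: "B $$ (1,0) \<noteq> 0"
  shows "kernel_dim B = 1"
proof -
  interpret kernel 2 2 B
    by unfold_locales (rule B)
  \<comment> \<open>The second row annihilates \<open>u\<close> by construction; the first row
    applied to \<open>u\<close> gives \<open>- det B\<close>, which vanishes.\<close>
  define u where "u = vec 2 (\<lambda>i. if i = 0 then - (B $$ (1,1)) else B $$ (1,0))"
  have u: "u \<in> carrier_vec 2" "u $ 0 = - (B $$ (1,1))" "u $ 1 = B $$ (1,0)"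
    by (simp_all add: u_def)
  have mult: "(B *\<^sub>v w) $ i = B $$ (i,0) * w $ 0 + B $$ (i,1) * w $ 1"
    if "w \<in> carrier_vec 2" "i < 2" for w i
    using that B by (auto simp: scalar_prod_def numeral_2_eq_2)
  have "B *\<^sub>v u = 0\<^sub>v 2"
  proof (rule eq_vecI)
    fix i :: nat
    assume "i < dim_vec (0\<^sub>v 2)"
    then have i: "i < 2"
      by simp
    show "(B *\<^sub>v u) $ i = 0\<^sub>v 2 $ i"
      using det i unfolding mult[OF u(1) i] det_2x2[OF B] u less_2_cases_iff
      by (auto simp: algebra_simps)
  qed (use B in auto)
  then have ker: "u \<in> mat_kernel B"
    by (rule mat_kernelI[OF B u(1)])
  have "Ker.span {u} = mat_kernel B"
  proof (rule equalityI)
    show "Ker.span {u} \<subseteq> mat_kernel B"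
      using ker by (simp add: Ker.span_is_subset2)
    show "mat_kernel B \<subseteq> Ker.span {u}"
    proof
      fix w
      assume w: "w \<in> mat_kernel B"
      then have w2: "w \<in> carrier_vec 2" "B *\<^sub>v w = 0\<^sub>v 2"
        using mat_kernelD[OF B] by auto
      then have "B $$ (1,0) * w $ 0 + B $$ (1,1) * w $ 1 = 0"
        using mult[of w 1] by simp
      then have "w $ 0 = w $ 1 / B $$ (1,0) * - (B $$ (1,1))"
        using nz by (simp add: field_simps eq_neg_iff_add_eq_0)
      then have "w = (w $ 1 / B $$ (1,0)) \<cdot>\<^sub>v u"
        using nz w2(1) u
        by (intro eq_vecI) (auto simp: less_2_cases_iff)
      moreover have "u \<in> Ker.span {u}"
        using ker Ker.in_own_span[of "{u}"] by simp
      ultimately show "w \<in> Ker.span {u}"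
        using ker submodule.smult_closed[OF Ker.span_is_submodule[of "{u}"], of "w $ 1 / B $$ (1,0)" u]
        by simp
    qed
  qed
  moreover have "u \<noteq> 0\<^sub>v 2"
    using u(3) nz by auto
  ultimately show ?thesis
    using ker by (simp add: Ker.dim1I)
qed

text \<open>By Vieta the other root is \<open>t - z\<close>, so the multiplicity is two exactly when
  the two roots coincide.\<close>

lemma order_monic_quadratic:
  fixes z :: "'a :: field"
  assumes root: "poly [:d, - t, 1:] z = 0"
  shows "Polynomial.order z [:d, - t, 1:] = (if 2 * z = t then 2 else 1)"
proof -
  have fac: "[:d, - t, 1:] = [:- z, 1:] * [:- (t - z), 1:]"
    using root by (simp add: algebra_simps)
  have z: "Polynomial.order z [:- z, 1:] = 1"
    using order_power_n_n[of z 1] by simp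
  moreover have "Polynomial.order z [:- (t - z), 1:] = (if 2 * z = t then 1 else 0)"
  proof (cases "2 * z = t")
    case True
    then have "t - z = z"
      by (simp add: algebra_simps)
    with z True show ?thesis
      by (simp only: if_True refl)
  next
    case False
    then have "poly [:z - t, 1:] z \<noteq> 0"
      by (simp add: algebra_simps)
    then show ?thesis
      using False order_0I[of "[:z - t, 1:]" z] by simp
  qed
  ultimately show ?thesis
    unfolding fac by (subst order_mult) auto
qed

section \<open>Roots of real quadratics\<close>

text \<open>Real roots are bounded one side at a time from the values at \<open>r\<close> and
  \<open>- r\<close>; nonreal roots form a conjugate pair with product \<open>d\<close>.\<close>

lemma norm_root_quadratic_le:
  fixes t d r :: real and z :: complex
  assumes root: "z\<^sup>2 - of_real t * z + of_real d = 0" and r: "0 < r"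
    and d: "d \<le> r\<^sup>2" and p1: "0 \<le> r\<^sup>2 - r * t + d" and p2: "0 \<le> r\<^sup>2 + r * t + d"
  shows "cmod z \<le> r"
proof (cases "Im z = 0")
  case True
  define x where "x = Re z"
  have z: "z = of_real x"
    using True by (simp add: x_def complex_eq_iff)
  have "complex_of_real (x\<^sup>2 - t * x + d) = 0"
    using root unfolding z by (simp only: of_real_add of_real_diff of_real_mult of_real_power)
  then have x: "x\<^sup>2 - t * x + d = 0"
    by (simp only: of_real_eq_0_iff)
  \<comment> \<open>The trace \<open>s\<close> is kept general so that the pair \<open>- x\<close>,
    \<open>- t\<close> yields the lower bound on \<open>x\<close>.\<close>
  have *: "y \<le> r" if "0 \<le> r\<^sup>2 - r * s + d" "y\<^sup>2 - s * y + d = 0" for y s :: real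
  proof (rule ccontr)
    assume "\<not> y \<le> r"
    then have y: "r < y"
      by simp
    \<comment> \<open>The other root is \<open>s - y\<close>. If \<open>y\<close> exceeds
      \<open>r\<close>, nonnegativity at \<open>r\<close> pushes the other root to at least
      \<open>r\<close>, and the product \<open>d\<close> would exceed
      \<open>r\<^sup>2\<close>.\<close>
    have "(r - y) * (r - (s - y)) = r\<^sup>2 - r * s + d"
      using that(2) by (simp add: algebra_simps power2_eq_square)
    then have "r \<le> s - y"
      using that(1) y mult_neg_pos[of "r - y" "r - (s - y)"] by linarith
    then have "r * r < y * (s - y)"
      using y r by (intro mult_less_le_imp_less) auto
    moreover have "y * (s - y) = s * y - y\<^sup>2"
      by (simp add: algebra_simps power2_eq_square)
    ultimately show False
      using that(2) d unfolding power2_eq_square[of r] by linarith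
  qed
  have "x \<le> r"
    using p1 x by (rule *)
  moreover have "- x \<le> r"
  proof (rule *)
    show "0 \<le> r\<^sup>2 - r * - t + d"
      using p2 by simp
    have "(- x)\<^sup>2 - - t * - x + d = x\<^sup>2 - t * x + d"
      by simp
    then show "(- x)\<^sup>2 - - t * - x + d = 0"
      unfolding x .
  qed
  ultimately show ?thesis
    by (simp add: z)
next
  case False
  have "Re (z\<^sup>2 - of_real t * z + of_real d) = 0" "Im (z\<^sup>2 - of_real t * z + of_real d) = 0"
    by (simp_all only: root zero_complex.simps)
  then have re: "(Re z)\<^sup>2 - (Im z)\<^sup>2 - t * Re z + d = 0" and im: "Im z * (2 * Re z - t) = 0"
    by (auto simp: power2_eq_square algebra_simps)
  \<comment> \<open>Off the real axis the imaginary part forces \<open>Re z = t / 2\<close>; the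
    real part then says that the squared modulus is \<open>d\<close>.\<close>
  from im False have "2 * Re z = t"
    by (metis eq_iff_diff_eq_0 mult_eq_0_iff)
  then have "t * Re z = 2 * (Re z)\<^sup>2"
    by (auto simp: power2_eq_square)
  with re have "d = (Re z)\<^sup>2 + (Im z)\<^sup>2"
    by linarith
  then have "(cmod z)\<^sup>2 = d"
    by (simp only: cmod_power2)
  with d have "(cmod z)\<^sup>2 \<le> r\<^sup>2"
    by (simp only:)
  then show ?thesis
    by (rule power2_le_imp_le) (use r in simp)
qed

text \<open>Outside the unit disc, \<open>z\<^sup>2 = t * z - d\<close> can be divided by
  \<open>z\<close>. This crude bound serves to bound spectral radii over an interval of
  \<open>q\<close>.\<close>

lemma norm_root_quadratic_le_coeffs:
  fixes t d z :: complex
  assumes "z\<^sup>2 - t * z + d = 0"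
  shows "cmod z \<le> 1 + cmod t + cmod d"
proof (cases "cmod z \<le> 1")
  case False
  have "z\<^sup>2 = t * z - d"
    using assms by (simp add: algebra_simps)
  then have "cmod z * cmod z \<le> cmod t * cmod z + cmod d"
    by (metis norm_triangle_ineq4 norm_mult power2_eq_square)
  also have "\<dots> \<le> cmod t * cmod z + cmod d * cmod z"
    using False by (simp add: mult_le_cancel_left1)
  finally have "cmod z * cmod z \<le> (cmod t + cmod d) * cmod z"
    by (simp only: distrib_right)
  then have "cmod z \<le> cmod t + cmod d"
    using False mult_right_le_imp_le[of "cmod z" "cmod z" "cmod t + cmod d"] by linarith
  then show ?thesis
    by simp
qed (smt (verit) norm_ge_zero)

text \<open>The hypothesis says that the quadratic is negative at \<open>- 1\<close>, so its smaller
  real root lies to the left of that point.\<close>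

lemma quadratic_root_below_minus_one:
  fixes t d :: real
  assumes "1 + t + d < 0"
  obtains x where "x < - 1" "x\<^sup>2 - t * x + d = 0"
proof -
  define s where "s = sqrt (t\<^sup>2 - 4 * d)"
  \<comment> \<open>This is four times the hypothesis, rearranged. It gives both a real square root
    \<open>s\<close> and \<open>(t - s) / 2 < - 1\<close>.\<close>
  have "(t + 2)\<^sup>2 < t\<^sup>2 - 4 * d"
    using assms by (simp add: power2_eq_square algebra_simps)
  moreover from this have "0 \<le> t\<^sup>2 - 4 * d"
    by (rule order_trans[OF zero_le_power2 less_imp_le])
  ultimately have s: "s\<^sup>2 = t\<^sup>2 - 4 * d" "t + 2 < s"
    unfolding s_def by (simp_all add: real_less_rsqrt)
  show ?thesis
  proof (rule that[of "(t - s) / 2"])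
    show "((t - s) / 2)\<^sup>2 - t * ((t - s) / 2) + d = 0"
      using s(1) by (simp add: power2_eq_square field_simps)
  qed (use s(2) in simp)
qed

section \<open>The symbols\<close>

definition symbol_det :: "real \<Rightarrow> real \<Rightarrow> real \<Rightarrow> real \<Rightarrow> real" where
  "symbol_det \<gamma> \<beta> h q = (1 - h * q * \<beta>) / (1 + h * \<gamma>)"

definition symbol_trace :: "real \<Rightarrow> real \<Rightarrow> real \<Rightarrow> real \<Rightarrow> real" where
  "symbol_trace \<gamma> \<beta> h q = 1 + symbol_det \<gamma> \<beta> h q - h\<^sup>2 * q / (1 + h * \<gamma>)"

lemma symbol_carrier: "symbol \<gamma> \<beta> h q \<in> carrier_mat 2 2"
  by (auto simp: symbol_def mat_of_rows_list_def)

lemma symbol_entry10: "symbol \<gamma> \<beta> h q $$ (1,0) = of_real (- (h * q / (1 + h * \<gamma>)))"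
  by (auto simp: symbol_def mat_of_rows_list_def)

lemma char_poly_symbol:
  "char_poly (symbol \<gamma> \<beta> h q) =
     [:of_real (symbol_det \<gamma> \<beta> h q), - of_real (symbol_trace \<gamma> \<beta> h q), 1:]"
proof -
  let ?A = "symbol \<gamma> \<beta> h q"
  have e: "?A $$ (0,0) = of_real (1 - h\<^sup>2 * q / (1 + h * \<gamma>))"
    "?A $$ (0,1) = of_real (h * (1 - h * q * \<beta>) / (1 + h * \<gamma>))"
    "?A $$ (1,1) = of_real ((1 - h * q * \<beta>) / (1 + h * \<gamma>))"
    by (auto simp: symbol_def mat_of_rows_list_def)
  \<comment> \<open>The first row of the symbol is \<open>(1, 0)\<close> plus \<open>h\<close> times
    the second, so the determinant reduces to the lower right entry.\<close>
  have "(1 - h * u) * d - h * d * - u = d" for u d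
    by (simp add: algebra_simps)
  from this[of "h * q / (1 + h * \<gamma>)" "(1 - h * q * \<beta>) / (1 + h * \<gamma>)"]
  have det: "(1 - h\<^sup>2 * q / (1 + h * \<gamma>)) * ((1 - h * q * \<beta>) / (1 + h * \<gamma>))
      - h * (1 - h * q * \<beta>) / (1 + h * \<gamma>) * - (h * q / (1 + h * \<gamma>)) = symbol_det \<gamma> \<beta> h q"
    by (simp add: symbol_det_def power2_eq_square mult.assoc)
  have tr: "(1 - h\<^sup>2 * q / (1 + h * \<gamma>)) + (1 - h * q * \<beta>) / (1 + h * \<gamma>) = symbol_trace \<gamma> \<beta> h q"
    by (simp add: symbol_trace_def symbol_det_def)
  show ?thesis
    unfolding char_poly_2x2[OF symbol_carrier] e symbol_entry10 det[symmetric] tr[symmetric]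
    by simp
qed

lemma eigenvalue_symbol:
  "eigenvalue (symbol \<gamma> \<beta> h q) z \<longleftrightarrow>
     z\<^sup>2 - of_real (symbol_trace \<gamma> \<beta> h q) * z + of_real (symbol_det \<gamma> \<beta> h q) = 0"
  unfolding eigenvalue_root_char_poly[OF symbol_carrier] char_poly_symbol
  by (simp add: power2_eq_square algebra_simps)

section \<open>Spectral radius and semisimplicity\<close>

lemma norm_eigenvalue_le_spectral_radius:
  assumes "A \<in> carrier_mat n n" "0 < n" "eigenvalue A z"
  shows "cmod z \<le> spectral_radius A"
  using spectral_radius_mem_max(2)[OF assms(1,2)] assms(3) by (auto simp: spectrum_def)

lemma spectral_radius_leI:
  assumes "A \<in> carrier_mat n n" "0 < n" "\<And>z. eigenvalue A z \<Longrightarrow> cmod z \<le> r"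
  shows "spectral_radius A \<le> r"
  using spectral_radius_mem_max(1)[OF assms(1,2)] assms(3) by (auto simp: spectrum_def)

text \<open>The lower left entry is nonzero, so every eigenspace is a line, and semisimple means
  that \<open>z\<close> is a simple root.\<close>

lemma semisimple_symbol_iff:
  assumes "h * q \<noteq> 0" "1 + h * \<gamma> \<noteq> 0"
  shows "semisimple_eigenvalue (symbol \<gamma> \<beta> h q) z \<longleftrightarrow>
    eigenvalue (symbol \<gamma> \<beta> h q) z \<and> 2 * z \<noteq> of_real (symbol_trace \<gamma> \<beta> h q)"
proof (cases "eigenvalue (symbol \<gamma> \<beta> h q) z")
  case True
  let ?A = "symbol \<gamma> \<beta> h q"
  have "poly (char_poly ?A) z = 0"
    using True eigenvalue_root_char_poly[OF symbol_carrier] by blast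
  then have order: "Polynomial.order z (char_poly ?A) =
      (if 2 * z = of_real (symbol_trace \<gamma> \<beta> h q) then 2 else 1)"
    unfolding char_poly_symbol by (rule order_monic_quadratic)
  have "char_matrix ?A z $$ (1,0) = ?A $$ (1,0)"
    using symbol_carrier[of \<gamma> \<beta> h q] by (auto simp: char_matrix_def)
  then have "kernel_dim (char_matrix ?A z) = 1"
    using assms True eigenvalue_det[OF symbol_carrier] symbol_entry10
    by (intro kernel_dim_2x2) (auto simp: symbol_carrier simp flip: of_real_mult of_real_add)
  then show ?thesis
    using True order by (simp add: semisimple_eigenvalue_def)
qed (simp add: semisimple_eigenvalue_def)

section \<open>The stability conditions as functions of \<open>q\<close> and
  \<open>h\<close>\<close>

lemma affine_nonneg_between:
  fixes a b :: real
  assumes "0 \<le> a + b * l" "0 \<le> a + b * u" "l \<le> q" "q \<le> u"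
  shows "0 \<le> a + b * q"
proof (cases "0 \<le> b")
  case True
  then have "b * l \<le> b * q"
    using assms by (simp add: mult_left_mono)
  then show ?thesis
    using assms by simp
next
  case False
  then have "b * u \<le> b * q"
    using assms by (simp add: mult_left_mono_neg)
  then show ?thesis
    using assms by simp
qed

text \<open>The left side is the characteristic polynomial at \<open>- 1\<close>; at
  \<open>q = L\<close> the numerator on the right is the quadratic in \<open>h\<close> that defines
  the threshold.\<close>

lemma symbol_poly_minus_one:
  assumes "1 + h * \<gamma> \<noteq> 0"
  shows "1 + symbol_trace \<gamma> \<beta> h q + symbol_det \<gamma> \<beta> h q
    = (4 - 2 * h * (q * \<beta> - \<gamma>) - q * h\<^sup>2) / (1 + h * \<gamma>)"
proof -
  have "2 + 2 * ((1 - h * q * \<beta>) / a) - h\<^sup>2 * q / a = (2 * a + 2 - 2 * h * q * \<beta> - h\<^sup>2 * q) / a"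
    if "a \<noteq> 0" for a
    using that by (simp add: field_simps)
  from this[OF assms] show ?thesis
    by (simp add: symbol_trace_def symbol_det_def algebra_simps)
qed

text \<open>With \<open>b = \<gamma> - L * \<beta>\<close>, the quadratic in \<open>h\<close> has
  the roots \<open>(b \<plusminus> s) / L\<close>, of opposite signs because
  \<open>\<bar>b\<bar> < s\<close>; the positive one is \<open>h_quad\<close>. Using
  \<open>sgn\<close> treats step sizes below, at and above the threshold at once.\<close>

lemma h_quad_sign:
  assumes L: "0 < L" and h: "0 < h"
  shows "sgn (4 - 2 * h * (L * \<beta> - \<gamma>) - L * h\<^sup>2) = sgn (h_quad \<gamma> \<beta> L - h)"
proof -
  define b where "b = \<gamma> - L * \<beta>"
  define s where "s = sqrt (b\<^sup>2 + 4 * L)"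
  have s2: "s\<^sup>2 = b\<^sup>2 + 4 * L"
    using L by (simp add: s_def)
  have "\<bar>b\<bar> < s"
    unfolding s_def using L by (intro real_less_rsqrt) simp
  moreover have "0 < L * h"
    using h L by simp
  ultimately have pos: "0 < L * h - b + s"
    by linarith
  \<comment> \<open>The first factor is positive, so the second one carries the sign.\<close>
  have "(L * h - b + s) * (b + s - L * h) = s\<^sup>2 - (L * h - b)\<^sup>2"
    by (simp add: algebra_simps power2_eq_square)
  also have "\<dots> = L * (4 + 2 * h * b - L * h\<^sup>2)"
    unfolding s2 by (simp add: algebra_simps power2_eq_square)
  finally have prod: "(L * h - b + s) * (b + s - L * h) = L * (4 + 2 * h * b - L * h\<^sup>2)" .
  have "sgn (L * (4 + 2 * h * b - L * h\<^sup>2)) = sgn ((L * h - b + s) * (b + s - L * h))"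
    unfolding prod ..
  then have "sgn (4 + 2 * h * b - L * h\<^sup>2) = sgn (b + s - L * h)"
    using L pos by (simp only: sgn_mult sgn_pos mult_1_left)
  also have "\<dots> = sgn ((b + s) / L - h)"
  proof -
    have "b + s - L * h = L * ((b + s) / L - h)"
      using L by (simp add: right_diff_distrib)
    then have "sgn (b + s - L * h) = sgn (L * ((b + s) / L - h))"
      by (rule arg_cong)
    then show ?thesis
      using L by (simp only: sgn_mult sgn_pos mult_1_left)
  qed
  finally have "sgn (4 + 2 * h * b - L * h\<^sup>2) = sgn ((b + s) / L - h)" .
  moreover have "4 - 2 * h * (L * \<beta> - \<gamma>) - L * h\<^sup>2 = 4 + 2 * h * b - L * h\<^sup>2"
    by (simp add: b_def algebra_simps)
  ultimately show ?thesis
    unfolding h_quad_def b_def[symmetric] s_def[symmetric] by (simp only:)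
qed

lemma symbol_det_affine: "symbol_det \<gamma> \<beta> h q = 1 / (1 + h * \<gamma>) + - (h * \<beta> / (1 + h * \<gamma>)) * q"
  by (simp add: symbol_det_def diff_divide_distrib)

lemma symbol_trace_affine:
  "symbol_trace \<gamma> \<beta> h q = 1 + 1 / (1 + h * \<gamma>) + - ((h * \<beta> + h\<^sup>2) / (1 + h * \<gamma>)) * q"
  unfolding symbol_trace_def symbol_det_affine by (simp add: add_divide_distrib algebra_simps)

section \<open>Uniform contraction below the threshold\<close>

lemma eventually_root_conditions_at_left_1:
  fixes t d :: real
  assumes "d < 1" "0 < 1 - t + d" "0 < 1 + t + d"
  shows "\<forall>\<^sub>F r in at_left 1. d \<le> r\<^sup>2 \<and> 0 \<le> r\<^sup>2 - r * t + d \<and> 0 \<le> r\<^sup>2 + r * t + d"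
proof -
  have "((\<lambda>r. r\<^sup>2) \<longlongrightarrow> 1\<^sup>2) (at_left (1::real))"
    "((\<lambda>r. r\<^sup>2 - r * t + d) \<longlongrightarrow> 1\<^sup>2 - 1 * t + d) (at_left 1)"
    "((\<lambda>r. r\<^sup>2 + r * t + d) \<longlongrightarrow> 1\<^sup>2 + 1 * t + d) (at_left 1)"
    by (intro tendsto_intros)+
  then have "\<forall>\<^sub>F r in at_left 1. d < r\<^sup>2" "\<forall>\<^sub>F r in at_left 1. 0 < r\<^sup>2 - r * t + d"
    "\<forall>\<^sub>F r in at_left 1. 0 < r\<^sup>2 + r * t + d"
    using assms by (auto intro: order_tendstoD(1))
  then show ?thesis
    by eventually_elim simp
qed

text \<open>For fixed \<open>r\<close> the three root conditions are affine in \<open>q\<close>,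
  hence pass from the endpoints to every point between them.\<close>

lemma spectral_radius_symbol_between:
  assumes "0 < r"
    and ends: "\<And>q. q \<in> {l, u} \<Longrightarrow> symbol_det \<gamma> \<beta> h q \<le> r\<^sup>2
        \<and> 0 \<le> r\<^sup>2 - r * symbol_trace \<gamma> \<beta> h q + symbol_det \<gamma> \<beta> h q
        \<and> 0 \<le> r\<^sup>2 + r * symbol_trace \<gamma> \<beta> h q + symbol_det \<gamma> \<beta> h q"
    and q: "l \<le> q" "q \<le> u"
  shows "spectral_radius (symbol \<gamma> \<beta> h q) \<le> r"
proof -
  obtain d0 d1 where d: "\<And>q. symbol_det \<gamma> \<beta> h q = d0 + d1 * q"
    using symbol_det_affine by blast
  obtain t0 t1 where t: "\<And>q. symbol_trace \<gamma> \<beta> h q = t0 + t1 * q"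
    using symbol_trace_affine by blast
  have "0 \<le> (r\<^sup>2 - d0) + - d1 * q"
    using ends[of l] ends[of u] by (intro affine_nonneg_between[OF _ _ q]) (auto simp: d)
  moreover have "0 \<le> (r\<^sup>2 - r * t0 + d0) + (d1 - r * t1) * q"
    using ends[of l] ends[of u] by (intro affine_nonneg_between[OF _ _ q]) (auto simp: d t algebra_simps)
  moreover have "0 \<le> (r\<^sup>2 + r * t0 + d0) + (d1 + r * t1) * q"
    using ends[of l] ends[of u] by (intro affine_nonneg_between[OF _ _ q]) (auto simp: d t algebra_simps)
  ultimately have "cmod z \<le> r" if "eigenvalue (symbol \<gamma> \<beta> h q) z" for z
    using that \<open>0 < r\<close>
    by (intro norm_root_quadratic_le[OF that[unfolded eigenvalue_symbol]])
      (auto simp: d t algebra_simps)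
  then show ?thesis
    by (intro spectral_radius_leI[OF symbol_carrier]) auto
qed

text \<open>One \<open>r\<close> serves the whole interval because only the two endpoints impose
  conditions on it, and each holds for all \<open>r\<close> close enough to 1 from below.\<close>

lemma symbol_uniform_contraction:
  assumes damping: "0 \<le> \<gamma>" "0 \<le> \<beta>" "(\<gamma>, \<beta>) \<noteq> (0, 0)"
    and "0 < \<mu>" "\<mu> \<le> L" and h: "0 < h" "h < h_quad \<gamma> \<beta> L"
  obtains r where "r < 1" "\<And>q. \<mu> \<le> q \<Longrightarrow> q \<le> L \<Longrightarrow> spectral_radius (symbol \<gamma> \<beta> h q) \<le> r"
proof -
  have a: "1 \<le> 1 + h * \<gamma>"
    using damping h by simp
  have conds: "symbol_det \<gamma> \<beta> h q < 1 \<and> 0 < 1 - symbol_trace \<gamma> \<beta> h q + symbol_det \<gamma> \<beta> h q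
      \<and> 0 < 1 + symbol_trace \<gamma> \<beta> h q + symbol_det \<gamma> \<beta> h q" if "0 < q" "q \<le> L" for q
  proof (intro conjI)
    \<comment> \<open>Damping enters here: one of the two summands is positive, which makes the
      determinant strictly less than 1.\<close>
    have "0 < h * q * \<beta> + h * \<gamma>"
      using damping h \<open>0 < q\<close> by (cases "\<gamma> = 0") (auto intro: add_nonneg_pos)
    then show "symbol_det \<gamma> \<beta> h q < 1"
      using a by (simp add: symbol_det_def)
    \<comment> \<open>The value at 1 equals
      \<open>h\<^sup>2 * q / (1 + h * \<gamma>)\<close>.\<close>
    show "0 < 1 - symbol_trace \<gamma> \<beta> h q + symbol_det \<gamma> \<beta> h q"
      using a h \<open>0 < q\<close> by (simp add: symbol_trace_def)
    \<comment> \<open>The numerator of the value at \<open>- 1\<close> is nonincreasing in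
      \<open>q\<close>, so its positivity at \<open>L\<close> suffices.\<close>
    have "q * (2 * h * \<beta> + h\<^sup>2) \<le> L * (2 * h * \<beta> + h\<^sup>2)"
      using damping h that by (intro mult_right_mono) auto
    moreover have "0 < 4 - 2 * h * (L * \<beta> - \<gamma>) - L * h\<^sup>2"
      using h_quad_sign[of L h \<beta> \<gamma>] that h by (simp add: sgn_1_pos)
    ultimately have "0 < 4 - 2 * h * (q * \<beta> - \<gamma>) - q * h\<^sup>2"
      by (simp add: algebra_simps)
    then show "0 < 1 + symbol_trace \<gamma> \<beta> h q + symbol_det \<gamma> \<beta> h q"
      using a by (subst symbol_poly_minus_one) auto
  qed
  have "\<forall>\<^sub>F r in at_left 1. 0 < (r::real) \<and> r < 1"
    using eventually_at_left_real[of 0 "1::real"] by (simp add: eventually_mono)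
  moreover have "\<forall>\<^sub>F r in at_left 1. symbol_det \<gamma> \<beta> h q \<le> r\<^sup>2
        \<and> 0 \<le> r\<^sup>2 - r * symbol_trace \<gamma> \<beta> h q + symbol_det \<gamma> \<beta> h q
        \<and> 0 \<le> r\<^sup>2 + r * symbol_trace \<gamma> \<beta> h q + symbol_det \<gamma> \<beta> h q" if "q \<in> {\<mu>, L}" for q
    using that conds[of q] \<open>0 < \<mu>\<close> \<open>\<mu> \<le> L\<close> by (intro eventually_root_conditions_at_left_1) auto
  then have "\<forall>\<^sub>F r in at_left 1. \<forall>q\<in>{\<mu>, L}. symbol_det \<gamma> \<beta> h q \<le> r\<^sup>2
        \<and> 0 \<le> r\<^sup>2 - r * symbol_trace \<gamma> \<beta> h q + symbol_det \<gamma> \<beta> h q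
        \<and> 0 \<le> r\<^sup>2 + r * symbol_trace \<gamma> \<beta> h q + symbol_det \<gamma> \<beta> h q"
    by (intro eventually_ball_finite) auto
  ultimately have "\<forall>\<^sub>F r in at_left 1. r < 1 \<and>
      (\<forall>q. \<mu> \<le> q \<longrightarrow> q \<le> L \<longrightarrow> spectral_radius (symbol \<gamma> \<beta> h q) \<le> r)"
    by eventually_elim (blast intro: spectral_radius_symbol_between)
  then show ?thesis
    using that eventually_happens'[OF trivial_limit_at_left_real] by blast
qed

text \<open>A real \<open>SUP\<close> is known to dominate its members only when they are bounded
  above; this supplies the bound.\<close>

lemma bdd_above_spectral_radius_symbol:
  "bdd_above ((\<lambda>q. spectral_radius (symbol \<gamma> \<beta> h q)) ` {l..u})"
proof -
  have "bounded ((\<lambda>q. (symbol_trace \<gamma> \<beta> h q, symbol_det \<gamma> \<beta> h q)) ` {l..u})"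
    unfolding symbol_trace_affine symbol_det_affine
    by (intro compact_imp_bounded compact_continuous_image continuous_intros) auto
  then obtain B where B: "\<And>q. q \<in> {l..u} \<Longrightarrow> norm (symbol_trace \<gamma> \<beta> h q, symbol_det \<gamma> \<beta> h q) \<le> B"
    unfolding bounded_iff by blast
  have "spectral_radius (symbol \<gamma> \<beta> h q) \<le> 1 + B + B" if "q \<in> {l..u}" for q
  proof (rule spectral_radius_leI[OF symbol_carrier])
    fix z
    assume "eigenvalue (symbol \<gamma> \<beta> h q) z"
    then have "cmod z \<le> 1 + \<bar>symbol_trace \<gamma> \<beta> h q\<bar> + \<bar>symbol_det \<gamma> \<beta> h q\<bar>"
      unfolding eigenvalue_symbol by (rule norm_root_quadratic_le_coeffs[THEN order_trans]) simp
    moreover have "\<bar>symbol_trace \<gamma> \<beta> h q\<bar> \<le> B" "\<bar>symbol_det \<gamma> \<beta> h q\<bar> \<le> B"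
      using B[OF that] norm_fst_le[of "symbol_trace \<gamma> \<beta> h q" "symbol_det \<gamma> \<beta> h q"]
        norm_snd_le[of "symbol_det \<gamma> \<beta> h q" "symbol_trace \<gamma> \<beta> h q"] by auto
    ultimately show "cmod z \<le> 1 + B + B"
      by simp
  qed simp
  then show ?thesis
    by (intro bdd_aboveI2) auto
qed

section \<open>The symbol at \<open>L\<close> on and beyond the threshold\<close>

lemma symbol_eigenvalue_minus_one:
  assumes "0 < L" "0 \<le> \<gamma>" "0 < h" "h = h_quad \<gamma> \<beta> L"
  shows "eigenvalue (symbol \<gamma> \<beta> h L) (- 1)"
proof -
  have "4 - 2 * h * (L * \<beta> - \<gamma>) - L * h\<^sup>2 = 0"
    using h_quad_sign[of L h \<beta> \<gamma>] assms by (simp add: sgn_0_0)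
  moreover have "1 + h * \<gamma> \<noteq> 0"
    using assms by (smt (verit) mult_nonneg_nonneg)
  ultimately have "1 + symbol_trace \<gamma> \<beta> h L + symbol_det \<gamma> \<beta> h L = 0"
    by (simp add: symbol_poly_minus_one)
  then have "complex_of_real (1 + symbol_trace \<gamma> \<beta> h L + symbol_det \<gamma> \<beta> h L) = 0"
    by (simp only: of_real_0)
  then show ?thesis
    unfolding eigenvalue_symbol by simp
qed

lemma symbol_unstable:
  assumes "0 < L" "0 \<le> \<gamma>" "0 < h" "h_quad \<gamma> \<beta> L < h"
  shows "unstable (symbol \<gamma> \<beta> h L)"
proof -
  have "4 - 2 * h * (L * \<beta> - \<gamma>) - L * h\<^sup>2 < 0"
    using h_quad_sign[of L h \<beta> \<gamma>] assms by (simp add: sgn_1_neg)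
  moreover have "0 < 1 + h * \<gamma>"
    using assms by (smt (verit) mult_nonneg_nonneg)
  ultimately have "1 + symbol_trace \<gamma> \<beta> h L + symbol_det \<gamma> \<beta> h L < 0"
    by (subst symbol_poly_minus_one) (auto simp: divide_neg_pos)
  then obtain x where x: "x < - 1" "x\<^sup>2 - symbol_trace \<gamma> \<beta> h L * x + symbol_det \<gamma> \<beta> h L = 0"
    by (rule quadratic_root_below_minus_one)
  have "complex_of_real (x\<^sup>2 - symbol_trace \<gamma> \<beta> h L * x + symbol_det \<gamma> \<beta> h L) = 0"
    using x(2) by (simp only: of_real_0)
  then have "eigenvalue (symbol \<gamma> \<beta> h L) (of_real x)"
    unfolding eigenvalue_symbol by simp
  from norm_eigenvalue_le_spectral_radius[OF symbol_carrier _ this] x(1) show ?thesis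
    by (simp add: unstable_def)
qed

section \<open>The undamped case\<close>

lemma symbol_undamped_marginally_stable:
  assumes "0 < q" "0 < h" "h\<^sup>2 * q < 4"
  shows "marginally_stable (symbol 0 0 h q)"
proof -
  let ?A = "symbol 0 0 h q"
  define t where "t = symbol_trace 0 0 h q"
  have d: "symbol_det 0 0 h q = 1" and t: "t = 2 - h\<^sup>2 * q"
    by (simp_all add: t_def symbol_det_def symbol_trace_def)
  have "0 < h\<^sup>2 * q"
    using assms by simp
  with assms(3) have abs_t: "\<bar>t\<bar> < 2"
    by (simp add: t abs_less_iff)
  \<comment> \<open>With \<open>r = 1\<close> and determinant 1 the root conditions amount to
    \<open>\<bar>t\<bar> \<le> 2\<close>.\<close>
  have le1: "cmod z \<le> 1" if "z\<^sup>2 - of_real t * z + of_real 1 = 0" for z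
    using that abs_t by (intro norm_root_quadratic_le[of z t 1]) auto
  have norm1: "cmod z = 1" if "eigenvalue ?A z" for z
  proof -
    have z: "z\<^sup>2 - of_real t * z + 1 = 0"
      using that by (simp add: eigenvalue_symbol d t_def)
    \<comment> \<open>Both roots lie in the closed unit disc, and their product is 1.\<close>
    have "z * (of_real t - z) = 1"
      using z by (simp add: algebra_simps power2_eq_square)
    moreover have "cmod z \<le> 1" "cmod (of_real t - z) \<le> 1"
      using z by (auto intro!: le1 simp: algebra_simps power2_eq_square)
    ultimately show ?thesis
      by (metis mult.commute mult_left_le norm_ge_zero norm_mult norm_one order_antisym)
  qed
  have "spectral_radius ?A = 1"
    using spectral_radius_mem_max(1)[OF symbol_carrier, of 0 0 h q] norm1 by (auto simp: spectrum_def)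
  moreover have "semisimple_eigenvalue ?A z" if "eigenvalue ?A z" for z
  proof -
    \<comment> \<open>A double root would be \<open>t / 2\<close>, of modulus below 1.\<close>
    have "2 * z \<noteq> of_real t"
    proof
      assume "2 * z = of_real t"
      then have "2 * cmod z = \<bar>t\<bar>"
        by (metis norm_mult norm_numeral norm_of_real)
      then show False
        using norm1[OF that] abs_t by simp
    qed
    then show ?thesis
      using that assms by (simp add: semisimple_symbol_iff t_def)
  qed
  ultimately show ?thesis
    by (simp add: marginally_stable_def)
qed

text \<open>With determinant 1 the eigenvalue \<open>- 1\<close> forces the trace
  \<open>- 2\<close>, so it is a double root and fails to be semisimple.\<close>

lemma symbol_undamped_not_marginally_stable:
  assumes "0 < L" "0 < h" "h = h_quad 0 0 L"
  shows "\<not> marginally_stable (symbol 0 0 h L)"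
proof -
  have ev: "eigenvalue (symbol 0 0 h L) (- 1)"
    using assms by (intro symbol_eigenvalue_minus_one) auto
  then have "complex_of_real (2 + symbol_trace 0 0 h L) = 0"
    by (simp add: eigenvalue_symbol symbol_det_def)
  then have "2 + symbol_trace 0 0 h L = 0"
    by (simp only: of_real_eq_0_iff)
  then have "\<not> semisimple_eigenvalue (symbol 0 0 h L) (- 1)"
    using assms by (subst semisimple_symbol_iff) (auto simp: add_eq_0_iff)
  then show ?thesis
    using ev by (auto simp: marginally_stable_def)
qed

section \<open>From the symbols to the iteration\<close>

theorem corollary5p6:
  fixes Q :: "'a::{real_inner, complete_space} \<Rightarrow>\<^sub>L 'a"
    and \<mu> L \<gamma> \<beta> h :: real
  assumes "self_adjoint Q"
    and "is_minimum (op_spectrum Q) \<mu>"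
    and "is_maximum (op_spectrum Q) L"
    and "0 < \<mu>"
    and "\<gamma> \<ge> 0" and "\<beta> \<ge> 0" and "h > 0"
  shows "((\<gamma>, \<beta>) \<noteq> (0, 0) \<longrightarrow>
            (uniformly_schur_stable Q \<gamma> \<beta> h \<longleftrightarrow> 0 < h \<and> h < h_quad \<gamma> \<beta> L))
       \<and> (h = h_quad \<gamma> \<beta> L \<longrightarrow> eigenvalue (symbol \<gamma> \<beta> h L) (- 1))
       \<and> (h > h_quad \<gamma> \<beta> L \<longrightarrow> unstable (symbol \<gamma> \<beta> h L))
       \<and> (\<gamma> = 0 \<and> \<beta> = 0 \<longrightarrow>
            (marginally_stable_iteration Q \<gamma> \<beta> h \<and> \<not> uniformly_schur_stable Q \<gamma> \<beta> h
               \<longleftrightarrow> 0 < h \<and> h < 2 / sqrt L))"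
proof -
  note \<mu> = assms(2)[unfolded is_minimum_def] and L = assms(3)[unfolded is_maximum_def]
  have "0 < L"
    using \<mu> L \<open>0 < \<mu>\<close> less_le_trans by blast
  have spec: "op_spectrum Q \<subseteq> {\<mu>..L}"
    using \<mu> L by auto
  have bdd: "bdd_above ((\<lambda>q. spectral_radius (symbol \<gamma> \<beta> h q)) ` op_spectrum Q)"
    using bdd_above_spectral_radius_symbol spec by (rule bdd_above_mono[OF _ image_mono])
  \<comment> \<open>\<open>L\<close> lies in the spectrum, so the supremum dominates the spectral
    radius there.\<close>
  have at_L: "spectral_radius (symbol \<gamma> \<beta> h L) < 1" if "uniformly_schur_stable Q \<gamma> \<beta> h"
    using that cSUP_upper[OF _ bdd, of L] L by (auto simp: uniformly_schur_stable_def)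
  have minus_one: "eigenvalue (symbol \<gamma> \<beta> h L) (- 1)" if "h = h_quad \<gamma> \<beta> L"
    using that \<open>0 < L\<close> assms(5,7) by (intro symbol_eigenvalue_minus_one)
  have unstable: "unstable (symbol \<gamma> \<beta> h L)" if "h_quad \<gamma> \<beta> L < h"
    using that \<open>0 < L\<close> assms(5,7) by (intro symbol_unstable)
  have "h < h_quad \<gamma> \<beta> L" if "uniformly_schur_stable Q \<gamma> \<beta> h"
  proof (rule ccontr)
    assume "\<not> h < h_quad \<gamma> \<beta> L"
    then have "1 \<le> spectral_radius (symbol \<gamma> \<beta> h L)"
      using minus_one norm_eigenvalue_le_spectral_radius[OF symbol_carrier, of \<gamma> \<beta> h L "- 1"]
        unstable by (cases "h = h_quad \<gamma> \<beta> L") (auto simp: unstable_def)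
    then show False
      using at_L[OF that] by simp
  qed
  moreover have "uniformly_schur_stable Q \<gamma> \<beta> h" if damped: "(\<gamma>, \<beta>) \<noteq> (0, 0)" and small: "h < h_quad \<gamma> \<beta> L"
  proof -
    obtain r where r: "r < 1"
      "\<And>q. \<mu> \<le> q \<Longrightarrow> q \<le> L \<Longrightarrow> spectral_radius (symbol \<gamma> \<beta> h q) \<le> r"
      using symbol_uniform_contraction[of \<gamma> \<beta> \<mu> L h thesis] assms(4-7) damped small \<mu> L by simp
    \<comment> \<open>The minimum \<open>\<mu>\<close> shows that the spectrum is nonempty, as
      \<open>cSUP_least\<close> requires.\<close>
    have "(SUP q\<in>op_spectrum Q. spectral_radius (symbol \<gamma> \<beta> h q)) \<le> r"
      using \<mu> L r(2) by (intro cSUP_least) auto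
    then show ?thesis
      using r(1) by (simp add: uniformly_schur_stable_def)
  qed
  moreover have "marginally_stable_iteration Q \<gamma> \<beta> h \<and> \<not> uniformly_schur_stable Q \<gamma> \<beta> h
      \<longleftrightarrow> h < 2 / sqrt L" if "\<gamma> = 0" "\<beta> = 0"
  proof -
    have hq: "h_quad \<gamma> \<beta> L = 2 / sqrt L"
      using that \<open>0 < L\<close> real_div_sqrt[of L]
      by (simp add: h_quad_def real_sqrt_mult frac_eq_eq mult.assoc)
    have "marginally_stable_iteration Q \<gamma> \<beta> h" if small: "h < 2 / sqrt L"
      unfolding marginally_stable_iteration_def
    proof
      fix q
      assume "q \<in> op_spectrum Q"
      then have q: "0 < q" "q \<le> L"
        using spec \<open>0 < \<mu>\<close> by auto
      have "h\<^sup>2 * L < 4"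
        using h_quad_sign[of L h \<beta> \<gamma>, unfolded hq] small \<open>0 < L\<close> \<open>h > 0\<close>
        by (simp add: sgn_1_pos \<open>\<gamma> = 0\<close> \<open>\<beta> = 0\<close> mult.commute)
      moreover have "h\<^sup>2 * q \<le> h\<^sup>2 * L"
        using q by (intro mult_left_mono) auto
      ultimately have "h\<^sup>2 * q < 4"
        by linarith
      then show "marginally_stable (symbol \<gamma> \<beta> h q)"
        using q \<open>h > 0\<close> symbol_undamped_marginally_stable[of q h] \<open>\<gamma> = 0\<close> \<open>\<beta> = 0\<close>
        by simp
    qed
    moreover have "h < 2 / sqrt L" if "marginally_stable_iteration Q \<gamma> \<beta> h"
    proof (rule ccontr)
      assume large: "\<not> h < 2 / sqrt L"
      have stable: "marginally_stable (symbol \<gamma> \<beta> h L)"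
        using that L by (simp add: marginally_stable_iteration_def)
      \<comment> \<open>Equality is ruled out by the defective eigenvalue \<open>- 1\<close>, so
        \<open>h\<close> is strictly beyond the threshold, where instability applies.\<close>
      then have "h \<noteq> h_quad \<gamma> \<beta> L"
        using symbol_undamped_not_marginally_stable[of L h] \<open>0 < L\<close> \<open>h > 0\<close>
        unfolding \<open>\<gamma> = 0\<close> \<open>\<beta> = 0\<close> by blast
      then have "1 < spectral_radius (symbol \<gamma> \<beta> h L)"
        using unstable large hq by (simp add: unstable_def)
      then show False
        using stable by (simp add: marginally_stable_def)
    qed
    \<comment> \<open>Marginal stability puts the spectral radius at \<open>L\<close> equal to 1, so
      the supremum cannot be below 1.\<close>
    moreover have "\<not> uniformly_schur_stable Q \<gamma> \<beta> h" if "marginally_stable_iteration Q \<gamma> \<beta> h"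
    proof -
      have "spectral_radius (symbol \<gamma> \<beta> h L) = 1"
        using that L by (simp add: marginally_stable_iteration_def marginally_stable_def)
      then show ?thesis
        using at_L by linarith
    qed
    ultimately show ?thesis
      by blast
  qed
  ultimately show ?thesis
    using minus_one unstable \<open>h > 0\<close> by (intro conjI impI iffI) simp_all
qed

end
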